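(* Let $T$ be a tree on $n$ vertices with diameter $d\geq 2$. Then $ABC_3(T)\leq (n-1)\sqrt{\tfrac12}$, with equality if and only if $T\in C_{n,3}\cup\{S_n\}$. Furthermore, when $n\geq 5$, among all trees on $n$ vertices that are not in $C_{n,3}\cup\{S_n\}$, the maximum value of $ABC_3$ is attained by the trees in $C_{n,4}$ (i.e., $C_{n,4}$ has the second maximal $ABC_3$ index among trees of order $n$).
   Context: All graphs are simple and connected. For a vertex $u$ of a graph $G$, the eccentricity $e_G(u)$ is $\max\{d_G(u,v): v\in V(G)\}$, where $d_G$ is the shortest-path distance. $ABC_3(G)=\sum_{uv\in E(G)}\sqrt{\frac{e_G(u)+e_G(v)-2}{e_G(u)e_G(v)}}$. $S_n$ is the star on $n$ vertices. For nonnegative integers $a_1,\ldots,a_{d-1}$, the caterpillar $C(a_1,\ldots,a_{d-1})$ is obtained from the path $v_0v_1\cdots v_d$ by attaching $a_i$ new pendent vertices to $v_i$ for $i=1,\ldots,d-1$. $C_{n,d}$ is the set of such caterpillars of order $n$ of the form $C(0,\ldots,0,a_{d/2},0,\ldots,0)$ when $d$ is even, and of the form $C(0,\ldots,0,a_{(d-1)/2},a_{(d+1)/2},0,\ldots,0)$ when $d$ is odd. In particular $C_{n,3}$ consists of the double stars of order $n$ and $C_{n,4}$ consists of the trees obtained from the path $v_0v_1v_2v_3v_4$ by attaching $n-5$ pendent vertices to $v_2$. *)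

theory Defs
  imports Complex_Main "Graph_Theory.Graph_Theory"
begin

text \<open>
  Finite simple undirected graphs are the loop-free symmetric pair digraphs
  (\<^locale>\<open>pair_graph\<close>); an undirected edge is the pair of its two opposite arcs.
\<close>

definition order_of :: "'a pair_pre_digraph \<Rightarrow> nat" where
  "order_of G = card (pverts G)"

definition uedges :: "'a pair_pre_digraph \<Rightarrow> 'a set set" where
  "uedges G = (\<lambda>(u, v). {u, v}) ` parcs G"

text \<open>
  In a symmetric digraph every edge yields a directed cycle of length two, so the library's
  \<^const>\<open>tree\<close> is not the undirected notion. A closed walk of length at least three
  without repeated vertices is exactly a cycle of the undirected graph.
\<close>

definition undirected_tree :: "'a pair_pre_digraph \<Rightarrow> bool" where
  "undirected_tree T \<longleftrightarrow> pair_graph T \<and> connected (with_proj T) \<and>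
     \<not> (\<exists>p. pre_digraph.cycle (with_proj T) p \<and> 3 \<le> length p)"

definition graph_dist :: "'a pair_pre_digraph \<Rightarrow> 'a \<Rightarrow> 'a \<Rightarrow> nat" where
  "graph_dist G u v = (LEAST k. \<exists>p. pre_digraph.awalk (with_proj G) u p v \<and> length p = k)"

definition eccentricity :: "'a pair_pre_digraph \<Rightarrow> 'a \<Rightarrow> nat" where
  "eccentricity G u = Max (graph_dist G u ` pverts G)"

definition graph_diameter :: "'a pair_pre_digraph \<Rightarrow> nat" where
  "graph_diameter G = Max (eccentricity G ` pverts G)"

text \<open>For an edge $e = \{u, v\}$ the inner sum is $e_G(u) + e_G(v)$ and the product $e_G(u) e_G(v)$.\<close>

definition ABC3 :: "'a pair_pre_digraph \<Rightarrow> real" where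
  "ABC3 G = (\<Sum>e\<in>uedges G.
     sqrt (((\<Sum>u\<in>e. real (eccentricity G u)) - 2) / (\<Prod>u\<in>e. real (eccentricity G u))))"

definition star_graph :: "nat \<Rightarrow> nat pair_pre_digraph" where
  "star_graph n = \<lparr> pverts = {..<n}, parcs = {0} \<times> {1..<n} \<union> {1..<n} \<times> {0} \<rparr>"

text \<open>
  The path vertex $v_i$ is \<open>(i, 0)\<close>; the pendent vertices attached to it are \<open>(i, j)\<close> with
  \<open>1 \<le> j \<le> a i\<close>. Only the values \<open>a 1, \<dots>, a (d - 1)\<close> matter.
\<close>

definition caterpillar :: "nat \<Rightarrow> (nat \<Rightarrow> nat) \<Rightarrow> (nat \<times> nat) pair_pre_digraph" where
  "caterpillar d a =
     (let E = {((i, 0), (Suc i, 0)) | i. i < d} \<union>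
              {((i, 0), (i, j)) | i j. i \<in> {1..<d} \<and> j \<in> {1..a i}}
      in \<lparr> pverts = {(i, 0) | i. i \<le> d} \<union> {(i, j) | i j. i \<in> {1..<d} \<and> j \<in> {1..a i}},
           parcs = E \<union> E\<inverse> \<rparr>)"

text \<open>As usual, graphs are identified up to isomorphism in the following two classes.\<close>

definition S_class :: "nat \<Rightarrow> 'a pair_pre_digraph set" where
  "S_class n = {G. pair_graph G \<and> digraph_iso (with_proj G) (with_proj (star_graph n))}"

definition C_class :: "nat \<Rightarrow> nat \<Rightarrow> 'a pair_pre_digraph set" where
  "C_class n d = {G. pair_graph G \<and> order_of G = n \<and>
     (\<exists>a. (\<forall>i\<in>{1..<d}. a i \<noteq> 0 \<longrightarrow>
             (if even d then i = d div 2 else i = (d - 1) div 2 \<or> i = (d + 1) div 2)) \<and>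
          digraph_iso (with_proj G) (with_proj (caterpillar d a)))}"

end

theory Submission
  imports Defs
begin

text \<open>
  Eccentricities of adjacent vertices are positive and differ by at most one, and for such $a, b$ the
  difference $1/2 - (a + b - 2)/(ab) = (a - 2)(b - 2)/(2ab)$ is nonnegative and vanishes only if
  $a = 2$ or $b = 2$. A tree has $n - 1$ edges, which gives the bound, with equality iff every edge has
  an end of eccentricity 2. The end edges of a diametral path rule this out if $d \<ge> 4$, while trees of
  diameter 2 and 3 are the stars and the double stars. If $d \<ge> 4$, the two end edges of a diametral path
  join eccentricities at least 4 and at least 3, so each contributes at most $\sqrt{5/12}$; the trees
  in $C_{n,4}$ attain these bounds on all edges.
\<close>

section \<open>Distances in connected graphs and trees\<close>

text \<open>Acyclicity is given only as the absence of closed simple walks of length at least 3, and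
  it enters only through \<open>arc_in_walk\<close>. From then on a tree is handled by distances
  from a root \<open>r\<close>: each edge joins a vertex to its parent, the ends of an edge are
  never equidistant from \<open>r\<close>, and no vertex has two neighbours closer to
  \<open>r\<close>. This yields the edge count. It also forces the shape of trees of diameter 2 and
  3, because a surplus vertex or edge would produce a distance above the diameter, a second parent
  or equidistant ends.

  The radicand 5/12 is (4 + 3 - 2) / (4 * 3), taken at the least eccentricities that an end edge can
  have when the diameter is at least 4. The other n - 3 edges are estimated by the general bound
  sqrt(1/2). In C_{n,4} they all contain the central vertex of eccentricity 2, so both estimates are
  sharp at once.\<close>

locale connected_pair_graph = pair_graph G for G :: "'a pair_pre_digraph" +
  assumes connected: "connected (with_proj G)"
begin

lemma verts_nonempty: "pverts G \<noteq> {}"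
  using connected by (auto simp: connected_def strongly_connected_def)

lemma ex_awalk:
  assumes "u \<in> pverts G" "v \<in> pverts G"
  shows "\<exists>p. awalk u p v"
proof -
  have "strongly_connected (with_proj G)"
    using symmetric_connected_imp_strongly_connected[OF pair_sym_arcs connected] .
  then show ?thesis
    using assms by (auto simp: strongly_connected_def reachable_awalk)
qed

lemma graph_dist_walk:
  assumes "u \<in> pverts G" "v \<in> pverts G"
  shows "\<exists>p. awalk u p v \<and> length p = graph_dist G u v"
proof -
  have "\<exists>k p. awalk u p v \<and> length p = k"
    using ex_awalk[OF assms] by blast
  from LeastI_ex[OF this] show ?thesis
    by (simp add: graph_dist_def)
qed

lemma graph_dist_le: "awalk u p v \<Longrightarrow> graph_dist G u v \<le> length p"
  unfolding graph_dist_def by (rule Least_le) blast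

lemma graph_dist_self [simp]: "u \<in> pverts G \<Longrightarrow> graph_dist G u u = 0"
  using graph_dist_le[of u "[]" u] by (simp add: awalk_simps)

lemma graph_dist_eq_0_iff:
  assumes "u \<in> pverts G" "v \<in> pverts G"
  shows "graph_dist G u v = 0 \<longleftrightarrow> u = v"
  using graph_dist_walk[OF assms] assms by (auto simp: awalk_simps)

lemma graph_dist_commute:
  assumes "u \<in> pverts G" "v \<in> pverts G"
  shows "graph_dist G u v = graph_dist G v u"
proof -
  have len: "length (rev_path p) = length p" for p :: "('a \<times> 'a) list"
    by (induction p) auto
  have "graph_dist G y x \<le> graph_dist G x y" if "x \<in> pverts G" "y \<in> pverts G" for x y
    using graph_dist_walk[OF that] graph_dist_le[of y "rev_path _" x] len
    by (metis awalk_rev_path)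
  then show ?thesis using assms by (simp add: eq_iff)
qed

lemma graph_dist_triangle:
  assumes "u \<in> pverts G" "v \<in> pverts G" "w \<in> pverts G"
  shows "graph_dist G u w \<le> graph_dist G u v + graph_dist G v w"
  using graph_dist_walk[OF assms(1,2)] graph_dist_walk[OF assms(2,3)]
    graph_dist_le[OF awalk_appendI] by (metis length_append)

lemma graph_dist_eq_1_iff:
  assumes "u \<in> pverts G" "v \<in> pverts G"
  shows "graph_dist G u v = 1 \<longleftrightarrow> (u, v) \<in> parcs G"
proof
  assume "graph_dist G u v = 1"
  with graph_dist_walk[OF assms] show "(u, v) \<in> parcs G"
    by (auto simp: length_Suc_conv awalk_simps)
next
  assume arc: "(u, v) \<in> parcs G"
  then have "graph_dist G u v \<le> 1"
    using graph_dist_le[of u "[(u, v)]" v] assms by (simp add: awalk_simps)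
  moreover have "graph_dist G u v \<noteq> 0"
    using arc no_loops' assms by (simp add: graph_dist_eq_0_iff)
  ultimately show "graph_dist G u v = 1" by simp
qed

lemma graph_dist_arc_le:
  assumes "r \<in> pverts G" "(x, y) \<in> parcs G"
  shows "graph_dist G r y \<le> Suc (graph_dist G r x)"
  using graph_dist_triangle[of r x y] graph_dist_eq_1_iff[of x y] assms wellformed'
  by (metis One_nat_def add.commute plus_1_eq_Suc)

text \<open>Take the second vertex of a shortest walk from \<open>x\<close> to \<open>r\<close>. It
  is not closer than \<open>k\<close>, since one arc changes the distance to \<open>r\<close> by at
  most one.\<close>

lemma graph_dist_Suc_obtain:
  assumes "r \<in> pverts G" "x \<in> pverts G" "graph_dist G r x = Suc k"
  obtains y where "(x, y) \<in> parcs G" "graph_dist G r y = k"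
proof -
  obtain p where p: "awalk x p r" "length p = Suc k"
    using graph_dist_walk[OF assms(2,1)] assms graph_dist_commute by metis
  then obtain y q where q: "p = (x, y) # q" "awalk y q r" and arc: "(x, y) \<in> parcs G"
    by (auto simp: length_Suc_conv awalk_simps)
  have y: "y \<in> pverts G" using arc wellformed' by blast
  have "graph_dist G r y \<le> k"
    using graph_dist_le[OF q(2)] p q graph_dist_commute[OF y assms(1)] by simp
  moreover have "Suc k \<le> Suc (graph_dist G r y)"
    using graph_dist_arc_le[OF assms(1) arcs_symmetric[OF arc]] assms(3) by simp
  ultimately show thesis using that arc by simp
qed

text \<open>Certificate for lower bounds on distances: a function rising by at most one along every
  arc cannot outrun the distance. It spares the determination of shortest walks in the trees of
  C_{n,4}.\<close>

lemma lipschitz_graph_dist: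
  fixes g :: "'a \<Rightarrow> nat"
  assumes g: "\<And>x y. (x, y) \<in> parcs G \<Longrightarrow> g y \<le> g x + 1"
    and "u \<in> pverts G" "v \<in> pverts G"
  shows "g v \<le> g u + graph_dist G u v"
proof -
  have "g v \<le> g u + length p" if "awalk u p v" for p
    using that
  proof (induction p arbitrary: u)
    case (Cons e p)
    then show ?case using g[of "fst e" "snd e"] by (force simp: awalk_simps)
  qed (simp add: awalk_simps)
  with graph_dist_walk[OF assms(2,3)] show ?thesis by metis
qed

lemma graph_dist_le_eccentricity:
  "v \<in> pverts G \<Longrightarrow> graph_dist G u v \<le> eccentricity G u"
  unfolding eccentricity_def using pair_finite_verts by (intro Max_ge) auto

lemma eccentricity_le_iff:
  "eccentricity G u \<le> k \<longleftrightarrow> (\<forall>v\<in>pverts G. graph_dist G u v \<le> k)"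
  unfolding eccentricity_def using pair_finite_verts verts_nonempty by (subst Max_le_iff) auto

lemma eccentricity_obtain:
  obtains v where "v \<in> pverts G" "graph_dist G u v = eccentricity G u"
proof -
  have "eccentricity G u \<in> graph_dist G u ` pverts G"
    unfolding eccentricity_def using pair_finite_verts verts_nonempty by (intro Max_in) auto
  then show thesis using that by force
qed

lemma eccentricity_le_diameter:
  "u \<in> pverts G \<Longrightarrow> eccentricity G u \<le> graph_diameter G"
  unfolding graph_diameter_def using pair_finite_verts by (intro Max_ge) auto

lemma graph_dist_le_diameter:
  "u \<in> pverts G \<Longrightarrow> v \<in> pverts G \<Longrightarrow> graph_dist G u v \<le> graph_diameter G"
  using graph_dist_le_eccentricity eccentricity_le_diameter le_trans by blast

text \<open>For \<open>v\<close> farthest from \<open>u\<close>, the eccentricity of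
  \<open>v\<close> is squeezed between the distance of the two and the diameter, so both ends attain
  the diameter.\<close>

lemma diameter_obtain:
  obtains u v where "u \<in> pverts G" "v \<in> pverts G" "graph_dist G u v = graph_diameter G"
    "eccentricity G u = graph_diameter G" "eccentricity G v = graph_diameter G"
proof -
  have "graph_diameter G \<in> eccentricity G ` pverts G"
    unfolding graph_diameter_def using pair_finite_verts verts_nonempty by (intro Max_in) auto
  then obtain u where u: "u \<in> pverts G" "eccentricity G u = graph_diameter G" by auto
  obtain v where v: "v \<in> pverts G" "graph_dist G u v = eccentricity G u"
    by (rule eccentricity_obtain)
  have "eccentricity G v = graph_diameter G"
    using eccentricity_le_diameter[OF v(1)] graph_dist_le_eccentricity[OF u(1), of v]
      graph_dist_commute[OF u(1) v(1)] u v by simp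
  with u v that show thesis by simp
qed

lemma eccentricity_arc_le:
  assumes "(x, y) \<in> parcs G"
  shows "eccentricity G y \<le> Suc (eccentricity G x)"
proof -
  have xy: "x \<in> pverts G" "y \<in> pverts G" using assms wellformed' by blast+
  have "graph_dist G y v \<le> Suc (eccentricity G x)" if "v \<in> pverts G" for v
    using graph_dist_arc_le[OF that assms] graph_dist_le_eccentricity[OF that, of x]
      graph_dist_commute xy that by (metis Suc_le_mono le_trans)
  then show ?thesis by (simp add: eccentricity_le_iff)
qed

lemma eccentricity_pos:
  assumes "(x, y) \<in> parcs G"
  shows "1 \<le> eccentricity G x"
  using graph_dist_eq_1_iff[of x y] graph_dist_le_eccentricity[of y x] assms wellformed' by metis

end

section \<open>Trees: parents and distances with respect to a root\<close>

locale undirected_tree_graph = connected_pair_graph +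
  assumes no_cycle: "\<And>p. cycle p \<Longrightarrow> length p < 3"
begin

text \<open>A walk avoiding the arc contains a simple path of length at least 2, which the arc closes to a cycle.\<close>

lemma arc_in_walk:
  assumes arc: "(x, y) \<in> parcs G" and walk: "awalk x p y"
  shows "(x, y) \<in> set p"
proof -
  define q where "q = awalk_to_apath p"
  have q: "apath x q y" "set q \<subseteq> set p"
    using apath_awalk_to_apath[OF walk] awalk_to_apath_subset[OF walk] by (simp_all add: q_def)
  have closed: "awalk x (q @ [(y, x)]) x"
    using q arc arcs_symmetric wellformed' by (auto simp: apath_def awalk_simps intro!: awalk_appendI)
  have "x \<noteq> y" using arc no_loops' by blast
  have "distinct (tl (pawalk_verts x (q @ [(y, x)])))"
  proof -
    have "pawalk_verts x (q @ [(y, x)]) = pawalk_verts x q @ [x]"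
      using awalk_verts_append[OF closed] by simp
    moreover obtain vs where "pawalk_verts x q = x # vs"
      using q(1) \<open>x \<noteq> y\<close> by (cases q) (auto simp: apath_simps)
    ultimately show ?thesis using q(1) by (auto simp: apath_def)
  qed
  with closed have "cycle (q @ [(y, x)])" by (auto simp: cycle_def)
  from no_cycle[OF this] have "length q \<le> 1" by simp
  with q(1) \<open>x \<noteq> y\<close> have "q = [(x, y)]"
    by (cases q) (auto simp: apath_simps)
  with q(2) show ?thesis by simp
qed

text \<open>Here \<open>par\<close> is any choice of a neighbour closer to the root. Climbing from
  \<open>x\<close> to \<open>r\<close> along \<open>par\<close> and descending to \<open>y\<close>
  gives a walk of parent arcs and their reverses; by \<open>arc_in_walk\<close> the arc itself
  occurs on it.\<close>

lemma arc_parent: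
  assumes r: "r \<in> pverts G"
    and par: "\<And>v. v \<in> pverts G \<Longrightarrow> v \<noteq> r \<Longrightarrow>
      (v, par v) \<in> parcs G \<and> graph_dist G r v = Suc (graph_dist G r (par v))"
    and arc: "(x, y) \<in> parcs G"
  shows "(x \<noteq> r \<and> y = par x) \<or> (y \<noteq> r \<and> x = par y)"
proof -
  have up: "\<exists>p. awalk v p r \<and> set p \<subseteq> {(w, par w) | w. w \<in> pverts G \<and> w \<noteq> r}"
    if "v \<in> pverts G" for v
    using that
  proof (induction "graph_dist G r v" arbitrary: v)
    case 0
    then have "v = r" using r graph_dist_eq_0_iff by metis
    then show ?case using r by (intro exI[of _ "[]"]) (simp add: awalk_simps)
  next
    case (Suc k)
    then have "v \<noteq> r" using r by auto
    with Suc par[of v] have v: "(v, par v) \<in> parcs G" "graph_dist G r (par v) = k" by auto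
    then obtain p where "awalk (par v) p r" "set p \<subseteq> {(w, par w) | w. w \<in> pverts G \<and> w \<noteq> r}"
      using Suc.hyps(1)[of "par v"] wellformed' by blast
    then show ?case using v Suc.prems \<open>v \<noteq> r\<close>
      by (intro exI[of _ "(v, par v) # p"]) (auto simp: awalk_simps)
  qed
  have xy: "x \<in> pverts G" "y \<in> pverts G" using arc wellformed' by blast+
  obtain p where p: "awalk x p r" "set p \<subseteq> {(w, par w) | w. w \<in> pverts G \<and> w \<noteq> r}"
    using up xy by blast
  obtain q where q: "awalk y q r" "set q \<subseteq> {(w, par w) | w. w \<in> pverts G \<and> w \<noteq> r}"
    using up xy by blast
  have rev: "set (rev_path q) = (\<lambda>(a, b). (b, a)) ` set q"
    by (induction q) auto
  have "awalk x (p @ rev_path q) y"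
    using p q by (intro awalk_appendI) auto
  from arc_in_walk[OF arc this] show ?thesis
    using p q by (auto simp: rev)
qed

lemma parent_obtain:
  assumes r: "r \<in> pverts G"
  obtains par where "\<And>v. v \<in> pverts G \<Longrightarrow> v \<noteq> r \<Longrightarrow>
    (v, par v) \<in> parcs G \<and> graph_dist G r v = Suc (graph_dist G r (par v))"
proof -
  have "\<exists>y. (v, y) \<in> parcs G \<and> graph_dist G r v = Suc (graph_dist G r y)"
    if v: "v \<in> pverts G" "v \<noteq> r" for v
  proof -
    obtain k where k: "graph_dist G r v = Suc k"
      using graph_dist_eq_0_iff[OF r v(1)] v(2) by (cases "graph_dist G r v") auto
    show ?thesis by (rule graph_dist_Suc_obtain[OF r v(1) k]) (use k in auto)
  qed
  then show thesis using that by metis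
qed

text \<open>Bipartiteness in metric form: an edge joins a child and its parent, so equal distances
  are impossible.\<close>

lemma graph_dist_arc_cases:
  assumes "r \<in> pverts G" "(x, y) \<in> parcs G"
  shows "graph_dist G r x = Suc (graph_dist G r y) \<or> graph_dist G r y = Suc (graph_dist G r x)"
  using parent_obtain[OF assms(1)] arc_parent[OF assms(1) _ assms(2)] assms(2) wellformed' by metis

text \<open>By \<open>arc_parent\<close> a neighbour \<open>w\<close> of \<open>x\<close> is
  \<open>par x\<close> or has \<open>x\<close> as its parent; in the second case \<open>w\<close> is
  farther from the root than \<open>x\<close>.\<close>

lemma parent_unique:
  assumes "r \<in> pverts G" "(x, y) \<in> parcs G" "(x, z) \<in> parcs G"
    and "graph_dist G r y < graph_dist G r x" "graph_dist G r z < graph_dist G r x"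
  shows "y = z"
proof -
  obtain par where par: "\<And>v. v \<in> pverts G \<Longrightarrow> v \<noteq> r \<Longrightarrow>
      (v, par v) \<in> parcs G \<and> graph_dist G r v = Suc (graph_dist G r (par v))"
    by (rule parent_obtain[OF assms(1)]) blast
  have "w = par x" if "(x, w) \<in> parcs G" "graph_dist G r w < graph_dist G r x" for w
    using arc_parent[OF assms(1) par that(1)] par[of w] that wellformed'
    by (metis Suc_lessD not_less_iff_gr_or_eq lessI)
  then show ?thesis using assms by blast
qed

text \<open>If \<open>z\<close> were closer to \<open>r\<close> than \<open>y\<close>, then
  \<open>x\<close> and \<open>z\<close> would be two closer neighbours of \<open>y\<close>. Repeated
  use pushes vertices beyond the diameter.\<close>

lemma graph_dist_no_backtrack:
  assumes "r \<in> pverts G" "(x, y) \<in> parcs G" "(y, z) \<in> parcs G" "x \<noteq> z"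
    and "graph_dist G r y = Suc (graph_dist G r x)"
  shows "graph_dist G r z = Suc (graph_dist G r y)"
  using graph_dist_arc_cases[OF assms(1,3)] parent_unique[OF assms(1) arcs_symmetric[OF assms(2)] assms(3)]
    assms by auto

lemma finite_uedges: "finite (uedges G)"
  unfolding uedges_def using pair_finite_arcs by simp

text \<open>Each edge is counted at its child, which can be any vertex but the root. The map is
  injective because two vertices cannot be parents of each other: each would be closer to the root
  than the other.\<close>

lemma card_uedges: "card (uedges G) = order_of G - 1"
proof -
  obtain r where r: "r \<in> pverts G" using verts_nonempty by blast
  obtain par where par: "\<And>v. v \<in> pverts G \<Longrightarrow> v \<noteq> r \<Longrightarrow>
      (v, par v) \<in> parcs G \<and> graph_dist G r v = Suc (graph_dist G r (par v))"
    by (rule parent_obtain[OF r]) blast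
  have "uedges G = (\<lambda>v. {v, par v}) ` (pverts G - {r})"
  proof
    show "uedges G \<subseteq> (\<lambda>v. {v, par v}) ` (pverts G - {r})"
      using arc_parent[OF r par] wellformed' unfolding uedges_def by fastforce
    show "(\<lambda>v. {v, par v}) ` (pverts G - {r}) \<subseteq> uedges G"
      using par unfolding uedges_def by fastforce
  qed
  moreover have "inj_on (\<lambda>v. {v, par v}) (pverts G - {r})"
  proof (rule inj_onI)
    fix v w assume v: "v \<in> pverts G - {r}" and w: "w \<in> pverts G - {r}"
      and "{v, par v} = {w, par w}"
    then have "v = w \<or> (v = par w \<and> w = par v)" by (auto simp: doubleton_eq_iff)
    then show "v = w" using par[of v] par[of w] v w by auto
  qed
  ultimately show ?thesis
    using r by (simp add: card_image order_of_def card_Diff_singleton)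
qed

end

lemma undirected_tree_iff: "undirected_tree T \<longleftrightarrow> undirected_tree_graph T"
  by (auto simp: undirected_tree_def undirected_tree_graph_def connected_pair_graph_def
      undirected_tree_graph_axioms_def connected_pair_graph_axioms_def not_le)


section \<open>Bounds on the index\<close>

definition abc_weight :: "nat \<Rightarrow> nat \<Rightarrow> real" where
  "abc_weight a b = sqrt ((real a + real b - 2) / (real a * real b))"

lemma
  assumes "1 \<le> a" "1 \<le> b" "a \<le> Suc b" "b \<le> Suc a"
  shows abc_weight_le: "abc_weight a b \<le> sqrt (1 / 2)"
    and abc_weight_eq_iff: "abc_weight a b = sqrt (1 / 2) \<longleftrightarrow> a = 2 \<or> b = 2"
proof -
  have pos: "0 < real a * real b" using assms by simp
  have key: "1 / 2 - (real a + real b - 2) / (real a * real b)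
      = (real a - 2) * (real b - 2) / (2 * (real a * real b))"
    using assms by (simp add: field_simps)
  have "0 \<le> (real a - 2) * (real b - 2)"
  \<comment> \<open>Integers differing by at most one cannot lie strictly on opposite sides of 2, so
    the two factors never have opposite signs.\<close>
  proof (cases "2 \<le> a \<and> 2 \<le> b")
    case False
    then have "a \<le> 2 \<and> b \<le> 2" using assms by auto
    then show ?thesis by (intro mult_nonpos_nonpos) auto
  qed auto
  then have "0 \<le> (real a - 2) * (real b - 2) / (2 * (real a * real b))"
    using pos by (intro divide_nonneg_pos) auto
  then show "abc_weight a b \<le> sqrt (1 / 2)"
    unfolding abc_weight_def using key by (intro real_sqrt_le_mono) linarith
  have "abc_weight a b = sqrt (1 / 2) \<longleftrightarrow> (real a + real b - 2) / (real a * real b) = 1 / 2"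
    by (simp only: abc_weight_def real_sqrt_eq_iff)
  also have "\<dots> \<longleftrightarrow> (real a - 2) * (real b - 2) / (2 * (real a * real b)) = 0"
    using key by linarith
  also have "\<dots> \<longleftrightarrow> a = 2 \<or> b = 2"
    using pos by auto
  finally show "abc_weight a b = sqrt (1 / 2) \<longleftrightarrow> a = 2 \<or> b = 2" .
qed

lemma abc_weight_le_4_3:
  assumes "4 \<le> a" "3 \<le> b"
  shows "abc_weight a b \<le> sqrt (5 / 12)"
proof -
  \<comment> \<open>The claim follows from 5ab - 12(a + b - 2) = 5(a - 4)(b - 3) + 3(a - 4) + 8(b -
    3).\<close>
  have "0 \<le> (real a - 4) * (real b - 3)" "4 \<le> real a" "3 \<le> real b" using assms by auto
  then have "12 * (real a + real b - 2) \<le> 5 * (real a * real b)"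
    by (simp add: algebra_simps)
  then show ?thesis
    unfolding abc_weight_def using assms by (intro real_sqrt_le_mono) (simp add: field_simps)
qed

section \<open>Edge weights in terms of eccentricities\<close>

context connected_pair_graph
begin

definition edge_weight :: "'a set \<Rightarrow> real" where
  "edge_weight e = sqrt (((\<Sum>u\<in>e. real (eccentricity G u)) - 2) / (\<Prod>u\<in>e. real (eccentricity G u)))"

lemma ABC3_eq: "ABC3 G = (\<Sum>e\<in>uedges G. edge_weight e)"
  by (simp add: ABC3_def edge_weight_def)

lemma edge_weight_arc:
  "(x, y) \<in> parcs G \<Longrightarrow> edge_weight {x, y} = abc_weight (eccentricity G x) (eccentricity G y)"
  using no_loops'[of x y] by (simp add: edge_weight_def abc_weight_def)

lemma uedges_cases:
  assumes "e \<in> uedges G"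
  obtains x y where "(x, y) \<in> parcs G" "e = {x, y}"
  using assms by (auto simp: uedges_def)

lemma
  assumes "e \<in> uedges G"
  shows edge_weight_le: "edge_weight e \<le> sqrt (1 / 2)"
    and edge_weight_eq_iff: "edge_weight e = sqrt (1 / 2) \<longleftrightarrow> (\<exists>x\<in>e. eccentricity G x = 2)"
proof -
  obtain x y where xy: "(x, y) \<in> parcs G" "e = {x, y}" using uedges_cases[OF assms] .
  have "1 \<le> eccentricity G x" "1 \<le> eccentricity G y"
    "eccentricity G x \<le> Suc (eccentricity G y)" "eccentricity G y \<le> Suc (eccentricity G x)"
    using xy(1) arcs_symmetric[OF xy(1)] eccentricity_pos eccentricity_arc_le by blast+
  from abc_weight_le[OF this] abc_weight_eq_iff[OF this] show
    "edge_weight e \<le> sqrt (1 / 2)"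
    "edge_weight e = sqrt (1 / 2) \<longleftrightarrow> (\<exists>x\<in>e. eccentricity G x = 2)"
    using edge_weight_arc[OF xy(1)] xy(2) by auto
qed

text \<open>A criterion in terms of adjacency alone, so that it can be checked directly on explicit
  arc sets. The vertex \<open>b\<close> is the witness for the lower bound.\<close>

lemma eccentricity_eq_2I:
  assumes x: "x \<in> pverts G"
    and near: "\<And>v. v \<in> pverts G \<Longrightarrow>
      v = x \<or> (x, v) \<in> parcs G \<or> (\<exists>w. (x, w) \<in> parcs G \<and> (w, v) \<in> parcs G)"
    and b: "b \<in> pverts G" "b \<noteq> x" "(x, b) \<notin> parcs G"
  shows "eccentricity G x = 2"
proof (rule antisym)
  have "graph_dist G x v \<le> 2" if "v \<in> pverts G" for v
    using near[OF that]
  proof (elim disjE exE conjE)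
    assume "v = x" then show ?thesis using x by simp
  next
    assume "(x, v) \<in> parcs G"
    then show ?thesis using graph_dist_eq_1_iff[OF x that] by simp
  next
    fix w assume w: "(x, w) \<in> parcs G" "(w, v) \<in> parcs G"
    then have "w \<in> pverts G" using wellformed' by blast
    then have "graph_dist G x w = 1" using w(1) x graph_dist_eq_1_iff by metis
    then show ?thesis using graph_dist_arc_le[OF x w(2)] by simp
  qed
  then show "eccentricity G x \<le> 2" by (simp add: eccentricity_le_iff)
  have "graph_dist G x b \<noteq> 0" "graph_dist G x b \<noteq> 1"
    using graph_dist_eq_0_iff[OF x b(1)] graph_dist_eq_1_iff[OF x b(1)] b by auto
  then show "2 \<le> eccentricity G x"
    using graph_dist_le_eccentricity[OF b(1), of x] by linarith
qed

end

section \<open>Upper bounds on the index of a tree\<close>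

context undirected_tree_graph
begin

lemma real_card_uedges: "real (card (uedges G)) = real (order_of G) - 1"
proof -
  have "0 < order_of G"
    using pair_finite_verts verts_nonempty by (simp add: order_of_def card_gt_0_iff)
  then show ?thesis by (simp add: card_uedges of_nat_diff)
qed

lemma ABC3_le: "ABC3 G \<le> (real (order_of G) - 1) * sqrt (1 / 2)"
  using sum_bounded_above[of "uedges G" edge_weight, OF edge_weight_le]
  by (simp add: ABC3_eq real_card_uedges)

lemma ABC3_eq_iff:
  "ABC3 G = (real (order_of G) - 1) * sqrt (1 / 2) \<longleftrightarrow>
     (\<forall>e\<in>uedges G. \<exists>x\<in>e. eccentricity G x = 2)"
proof -
  have "ABC3 G = (real (order_of G) - 1) * sqrt (1 / 2) \<longleftrightarrow>
      (\<Sum>e\<in>uedges G. sqrt (1 / 2) - edge_weight e) = 0"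
    by (simp add: ABC3_eq sum_subtractf real_card_uedges) linarith
  also have "\<dots> \<longleftrightarrow> (\<forall>e\<in>uedges G. sqrt (1 / 2) - edge_weight e = 0)"
    using edge_weight_le finite_uedges by (intro sum_nonneg_eq_0_iff) auto
  also have "\<dots> \<longleftrightarrow> (\<forall>e\<in>uedges G. edge_weight e = sqrt (1 / 2))"
    by auto
  also have "\<dots> \<longleftrightarrow> (\<forall>e\<in>uedges G. \<exists>x\<in>e. eccentricity G x = 2)"
    by (intro ball_cong refl edge_weight_eq_iff)
  finally show ?thesis .
qed

text \<open>A vertex of positive eccentricity has a neighbour, and along an edge the eccentricity
  drops by at most one.\<close>

lemma end_edge_obtain:
  assumes u: "u \<in> pverts G" "eccentricity G u = Suc k"
  obtains u' where "(u, u') \<in> parcs G" "{u, u'} \<in> uedges G" "k \<le> eccentricity G u'"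
proof -
  obtain v where v: "v \<in> pverts G" "graph_dist G u v = Suc k"
    using eccentricity_obtain u(2) by metis
  have "graph_dist G v u = Suc k" using graph_dist_commute[OF u(1) v(1)] v by simp
  then obtain u' where u': "(u, u') \<in> parcs G"
    using graph_dist_Suc_obtain[OF v(1) u(1)] by metis
  have "Suc k \<le> Suc (eccentricity G u')"
    using eccentricity_arc_le[OF arcs_symmetric[OF u']] u by simp
  with u' that show thesis by (force simp: uedges_def)
qed

lemma diameter_le_3:
  assumes "\<And>e. e \<in> uedges G \<Longrightarrow> \<exists>x\<in>e. eccentricity G x = 2"
  shows "graph_diameter G \<le> 3"
proof (rule ccontr)
  assume large: "\<not> ?thesis"
  obtain u v where u: "u \<in> pverts G" "eccentricity G u = graph_diameter G"
    by (rule diameter_obtain)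
  obtain u' where "{u, u'} \<in> uedges G" "graph_diameter G - 1 \<le> eccentricity G u'"
    using end_edge_obtain[OF u(1), of "graph_diameter G - 1"] u(2) large by (metis Suc_diff_1 not_le zero_less_Suc less_trans numeral_3_eq_3)
  with assms[of "{u, u'}"] u large show False by auto
qed

lemma ABC3_le_diameter_ge_4:
  assumes large: "4 \<le> graph_diameter G"
  shows "ABC3 G \<le> (real (order_of G) - 3) * sqrt (1 / 2) + 2 * sqrt (5 / 12)"
proof -
  obtain u v where uv: "u \<in> pverts G" "v \<in> pverts G" "graph_dist G u v = graph_diameter G"
    and ecc: "eccentricity G u = graph_diameter G" "eccentricity G v = graph_diameter G"
    by (rule diameter_obtain)
  have d: "graph_diameter G = Suc (graph_diameter G - 1)" using large by simp
  obtain u' where u': "(u, u') \<in> parcs G" "{u, u'} \<in> uedges G" "graph_diameter G - 1 \<le> eccentricity G u'"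
    using end_edge_obtain[OF uv(1)] ecc(1) d by metis
  obtain v' where v': "(v, v') \<in> parcs G" "{v, v'} \<in> uedges G" "graph_diameter G - 1 \<le> eccentricity G v'"
    using end_edge_obtain[OF uv(2)] ecc(2) d by metis
  have "{u, u'} \<noteq> {v, v'}"
  proof
    assume "{u, u'} = {v, v'}"
    then have "u = v \<or> (u, v) \<in> parcs G" using u' by (auto simp: doubleton_eq_iff)
    then have "graph_dist G u v \<le> 1"
      using uv graph_dist_eq_1_iff[OF uv(1,2)] by auto
    with uv large show False by simp
  qed
  define P where "P = {{u, u'}, {v, v'}}"
  have P: "P \<subseteq> uedges G" "finite P" "card P = 2"
    using u' v' \<open>{u, u'} \<noteq> {v, v'}\<close> by (auto simp: P_def)
  have "edge_weight e \<le> sqrt (5 / 12)" if "e \<in> P" for e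
    using that u' v' ecc large
    by (auto simp: P_def edge_weight_arc intro!: abc_weight_le_4_3)
  then have "sum edge_weight P \<le> 2 * sqrt (5 / 12)"
    using sum_bounded_above[of P edge_weight] P by force
  moreover have "sum edge_weight (uedges G - P) \<le> real (card (uedges G - P)) * sqrt (1 / 2)"
    using edge_weight_le by (intro sum_bounded_above) auto
  moreover have "real (card (uedges G - P)) = real (order_of G) - 3"
    using P finite_uedges card_mono[OF finite_uedges P(1)] real_card_uedges
    by (simp add: card_Diff_subset of_nat_diff)
  moreover have "ABC3 G = sum edge_weight (uedges G - P) + sum edge_weight P"
    unfolding ABC3_eq using P finite_uedges by (intro sum.subset_diff)
  ultimately show ?thesis by simp
qed

end


section \<open>Stars and double stars\<close>

text \<open>A library isomorphism maps vertices and arcs separately. In a pair digraph an arc is the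
  pair of its ends, so the arc map is induced by the vertex map.\<close>

lemma digraph_iso_with_proj_iff:
  assumes "pair_wf_digraph G"
  shows "digraph_iso (with_proj G) (with_proj H) \<longleftrightarrow>
    (\<exists>f. inj_on f (pverts G) \<and> f ` pverts G = pverts H \<and> map_prod f f ` parcs G = parcs H)"
    (is "?L \<longleftrightarrow> ?R")
proof -
  interpret pair_wf_digraph G by fact
  show ?thesis
  proof
    assume ?L
    then obtain h where h: "pre_digraph.digraph_isomorphism (with_proj G) h"
      and H: "with_proj H = app_iso h (with_proj G)"
      by (auto simp: digraph_iso_def)
    \<comment> \<open>The record equality forces the new tail and head functions to be
      \<open>fst\<close> and \<open>snd\<close>; this makes the arc map act componentwise.\<close>
    have eqs: "pverts H = iso_verts h ` pverts G" "parcs H = iso_arcs h ` parcs G"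
      "iso_tail h = fst" "iso_head h = snd"
      using H by (auto simp: with_proj_def app_iso_def)
    have "iso_arcs h e = map_prod (iso_verts h) (iso_verts h) e" if "e \<in> parcs G" for e
      using h that eqs by (auto simp: pre_digraph.digraph_isomorphism_def prod_eq_iff)
    then have "iso_arcs h ` parcs G = map_prod (iso_verts h) (iso_verts h) ` parcs G"
      by (intro image_cong refl)
    with h eqs show ?R
      by (intro exI[of _ "iso_verts h"]) (auto simp: pre_digraph.digraph_isomorphism_def)
  next
    assume ?R
    then obtain f where f: "inj_on f (pverts G)" "f ` pverts G = pverts H"
      "map_prod f f ` parcs G = parcs H" by blast
    define h where "h = \<lparr>iso_verts = f, iso_arcs = map_prod f f, iso_head = snd, iso_tail = fst\<rparr>"
    have "inj_on (map_prod f f) (parcs G)"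
      by (rule inj_on_subset[OF map_prod_inj_on[OF f(1) f(1)]]) (use wellformed' in auto)
    then have "pre_digraph.digraph_isomorphism (with_proj G) h"
      using f wf_digraph_wp_iff[of G] assms
      by (auto simp: pre_digraph.digraph_isomorphism_def h_def)
    moreover have "with_proj H = app_iso h (with_proj G)"
      using f by (simp add: with_proj_def app_iso_def h_def)
    ultimately show ?L by (auto simp: digraph_iso_def)
  qed
qed

text \<open>The bijection is inverted to run from the model \<open>H\<close> to \<open>G\<close>, so
  that \<open>G\<close> can be read off as the image of an explicit graph.\<close>

lemma digraph_iso_with_proj_obtain:
  assumes "pair_wf_digraph G" "digraph_iso (with_proj G) (with_proj H)"
  obtains f where "inj_on f (pverts H)" "pverts G = f ` pverts H" "parcs G = map_prod f f ` parcs H"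
proof -
  interpret pair_wf_digraph G by fact
  obtain g where g: "inj_on g (pverts G)" "g ` pverts G = pverts H" "map_prod g g ` parcs G = parcs H"
    using assms by (auto simp: digraph_iso_with_proj_iff)
  define f where "f = the_inv_into (pverts G) g"
  have fg: "f (g x) = x" if "x \<in> pverts G" for x
    using g(1) that by (simp add: f_def the_inv_into_f_f)
  have "inj_on f (pverts H)"
    unfolding f_def using g(1,2) by (metis inj_on_the_inv_into)
  moreover have "pverts G = f ` pverts H"
    unfolding g(2)[symmetric] using fg by force
  moreover have "map_prod f f ` parcs H = (\<lambda>e. e) ` parcs G"
    unfolding g(3)[symmetric] image_image
    by (intro image_cong) (use fg wellformed' in auto)
  ultimately show thesis using that by simp
qed

text \<open>Common building block: stars, double stars and the trees in C_{n,4} are unions of such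
  sets, and vertex maps send them to sets of the same form.\<close>

definition star_arcs :: "'a \<Rightarrow> 'a set \<Rightarrow> 'a rel" where
  "star_arcs c A = {c} \<times> A \<union> A \<times> {c}"

lemma map_prod_star_arcs: "map_prod f f ` star_arcs c A = star_arcs (f c) (f ` A)"
  unfolding star_arcs_def by auto

lemma star_graph_eq:
  "star_graph n = \<lparr>pverts = {..<n}, parcs = star_arcs 0 {1..<n}\<rparr>"
  by (simp add: star_graph_def star_arcs_def)

text \<open>The path ends \<open>(0, 0)\<close> and \<open>(3, 0)\<close> are leaves like the
  pendent vertices, so the caterpillar is a double star with centres \<open>(1, 0)\<close> and
  \<open>(2, 0)\<close>.\<close>

lemma caterpillar_3_eq:
  "caterpillar 3 a = \<lparr>
     pverts = {(1, 0), (2, 0)} \<union> insert (0, 0) (Pair 1 ` {1..a 1}) \<union> insert (3, 0) (Pair 2 ` {1..a 2}),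
     parcs = star_arcs (1, 0) (insert (0, 0) (Pair 1 ` {1..a 1})) \<union>
       star_arcs (2, 0) (insert (3, 0) (Pair 2 ` {1..a 2})) \<union> star_arcs (1, 0) {(2, 0)}\<rparr>"
proof -
  have le: "i \<le> 3 \<longleftrightarrow> i = 0 \<or> i = 1 \<or> i = 2 \<or> i = 3" for i :: nat by auto
  have inner: "i \<in> {1..<3} \<longleftrightarrow> i = 1 \<or> i = 2" for i :: nat by auto
  have verts: "{(i::nat, 0::nat) | i. i \<le> 3} = {(1, 0), (2, 0), (0, 0), (3, 0)}"
    unfolding le by blast
  have pendent: "{(i, j) | i j. i \<in> {1..<3} \<and> j \<in> {1..a i}} = Pair 1 ` {1..a 1} \<union> Pair 2 ` {1..a 2}"
    unfolding inner by blast
  have path: "{((i, 0::nat), (Suc i, 0::nat)) | i. i < 3} =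
      {((0, 0), (1, 0)), ((1, 0), (2, 0)), ((2, 0), (3, 0))}"
    by (auto simp: less_Suc_eq numeral_3_eq_3)
  have pendent_arcs: "{((i, 0::nat), (i, j)) | i j. i \<in> {1..<3} \<and> j \<in> {1..a i}} =
      {(1, 0)} \<times> Pair 1 ` {1..a 1} \<union> {(2, 0)} \<times> Pair 2 ` {1..a 2}"
    unfolding inner by blast
  \<comment> \<open>This brings the right-hand side into the form of a relation joined with its
    converse, as in the definition of \<open>caterpillar\<close>.\<close>
  have conv: "star_arcs c X = {c} \<times> X \<union> ({c} \<times> X)\<inverse>" for c and X :: "(nat \<times> nat) set"
    by (auto simp: star_arcs_def)
  show ?thesis
    unfolding caterpillar_def Let_def verts pendent path pendent_arcs
    unfolding conv converse_Un by (rule pair_pre_digraph.equality; simp; fast)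
qed

text \<open>A star around \<open>(2, 0)\<close> in which the two leaves \<open>(1, 0)\<close> and
  \<open>(3, 0)\<close> are each extended by one more vertex.\<close>

lemma caterpillar_4_eq:
  assumes "a 1 = 0" "a 3 = 0"
  shows "caterpillar 4 a = \<lparr>
     pverts = {(2, 0), (0, 0), (4, 0)} \<union> ({(1, 0), (3, 0)} \<union> Pair 2 ` {1..a 2}),
     parcs = star_arcs (2, 0) ({(1, 0), (3, 0)} \<union> Pair 2 ` {1..a 2}) \<union>
       star_arcs (1, 0) {(0, 0)} \<union> star_arcs (3, 0) {(4, 0)}\<rparr>"
proof -
  have le: "i \<le> 4 \<longleftrightarrow> i = 0 \<or> i = 1 \<or> i = 2 \<or> i = 3 \<or> i = 4" for i :: nat by auto
  have inner: "i \<in> {1..<4} \<and> j \<in> {1..a i} \<longleftrightarrow> i = 2 \<and> j \<in> {1..a 2}" for i j :: nat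
  proof -
    have "i \<in> {1..<4} \<longleftrightarrow> i = 1 \<or> i = 2 \<or> i = 3" by auto
    then show ?thesis using assms by auto
  qed
  have verts: "{(i::nat, 0::nat) | i. i \<le> 4} = {(2, 0), (0, 0), (4, 0), (1, 0), (3, 0)}"
    unfolding le by blast
  have pendent: "{(i, j) | i j. i \<in> {1..<4} \<and> j \<in> {1..a i}} = Pair 2 ` {1..a 2}"
    unfolding inner by blast
  have path: "{((i, 0::nat), (Suc i, 0::nat)) | i. i < 4} =
      {((0, 0), (1, 0)), ((1, 0), (2, 0)), ((2, 0), (3, 0)), ((3, 0), (4, 0))}"
    by (auto simp: less_Suc_eq eval_nat_numeral)
  have pendent_arcs: "{((i, 0::nat), (i, j)) | i j. i \<in> {1..<4} \<and> j \<in> {1..a i}} =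
      {(2, 0)} \<times> Pair 2 ` {1..a 2}"
    unfolding inner by blast
  have conv: "star_arcs c X = {c} \<times> X \<union> ({c} \<times> X)\<inverse>" for c and X :: "(nat \<times> nat) set"
    by (auto simp: star_arcs_def)
  show ?thesis
    unfolding caterpillar_def Let_def verts pendent path pendent_arcs
    unfolding conv converse_Un by (rule pair_pre_digraph.equality; simp; fast)
qed

section \<open>Every edge of a star or double star has an end of eccentricity 2\<close>

context connected_pair_graph
begin

text \<open>The end of eccentricity 2 is the leaf, not the centre: order at least 3 provides a
  second leaf, at distance 2.\<close>

lemma star_eccentricity_2:
  assumes V: "pverts G = insert c A" "c \<notin> A" and E: "parcs G = star_arcs c A"
    and order: "3 \<le> order_of G" and e: "e \<in> uedges G"
  shows "\<exists>x\<in>e. eccentricity G x = 2"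
proof -
  obtain u v where uv: "(u, v) \<in> star_arcs c A" "e = {u, v}"
    using uedges_cases[OF e] unfolding E .
  then obtain x where x: "x \<in> A" "e = {c, x}"
    by (auto simp: star_arcs_def insert_commute)
  have "A \<noteq> {x}"
  proof
    assume "A = {x}"
    then have "card (pverts G) = 2" using V x by (simp add: card_insert_if)
    with order show False by (simp add: order_of_def)
  qed
  then obtain b where b: "b \<in> A" "b \<noteq> x" using x by blast
  have "eccentricity G x = 2"
    by (rule eccentricity_eq_2I[of x b]) (use V E x b in \<open>auto simp: star_arcs_def\<close>)
  with x show ?thesis by blast
qed

text \<open>A leaf of the other centre is at distance 2. The lemma treats one centre and is applied
  twice, with the roles exchanged.\<close>

lemma double_star_center_eccentricity:
  assumes V: "pverts G = {x, y} \<union> A \<union> B"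
    and E: "parcs G = star_arcs x A \<union> star_arcs y B \<union> star_arcs x {y}"
    and B: "B \<noteq> {}" "x \<noteq> y" "x \<notin> B" "y \<notin> B" "A \<inter> B = {}"
  shows "eccentricity G x = 2"
proof -
  obtain b where "b \<in> B" using B by blast
  then show ?thesis
    by (intro eccentricity_eq_2I[of x b]) (use V E B in \<open>auto simp: star_arcs_def\<close>)
qed

lemma double_star_eccentricity_2:
  assumes V: "pverts G = {x, y} \<union> A \<union> B"
    and E: "parcs G = star_arcs x A \<union> star_arcs y B \<union> star_arcs x {y}"
    and disj: "A \<noteq> {}" "B \<noteq> {}" "x \<noteq> y" "x \<notin> A" "y \<notin> A" "x \<notin> B" "y \<notin> B" "A \<inter> B = {}"
    and e: "e \<in> uedges G"
  shows "\<exists>z\<in>e. eccentricity G z = 2"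
proof -
  have "eccentricity G x = 2"
    by (rule double_star_center_eccentricity[OF V E]) (use disj in auto)
  moreover have "eccentricity G y = 2"
    by (rule double_star_center_eccentricity[of y x B A]) (use V E disj in \<open>auto simp: star_arcs_def\<close>)
  ultimately show ?thesis
    using e E by (fastforce simp: uedges_def star_arcs_def)
qed

lemma S_class_eccentricity_2:
  assumes G: "G \<in> S_class n" and order: "3 \<le> order_of G" and e: "e \<in> uedges G"
  shows "\<exists>x\<in>e. eccentricity G x = 2"
proof -
  have "pair_wf_digraph G" by unfold_locales
  then obtain f where f: "inj_on f {..<n}" "pverts G = f ` {..<n}"
    "parcs G = star_arcs (f 0) (f ` {1..<n})"
    using G digraph_iso_with_proj_obtain[of G "star_graph n"]
    by (auto simp: S_class_def star_graph_eq map_prod_star_arcs)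
  have "n \<noteq> 0" using verts_nonempty f(2) by auto
  then have n: "{..<n} = insert 0 {1..<n}" by auto
  have "f 0 \<notin> f ` {1..<n}" using f(1) unfolding n by (subst (asm) inj_on_insert) auto
  then show ?thesis
    using star_eccentricity_2[of "f 0" "f ` {1..<n}"] f n order e by simp
qed

lemma C_class_3_eccentricity_2:
  assumes G: "G \<in> C_class n 3" and e: "e \<in> uedges G"
  shows "\<exists>x\<in>e. eccentricity G x = 2"
proof -
  have "pair_wf_digraph G" by unfold_locales
  with G obtain a where iso: "digraph_iso (with_proj G) (with_proj (caterpillar 3 a))"
    by (auto simp: C_class_def)
  define L R where "L = insert (0::nat, 0::nat) (Pair 1 ` {1..a 1})"
    and "R = insert (3::nat, 0::nat) (Pair 2 ` {1..a 2})"
  obtain f where f: "inj_on f ({(1, 0), (2, 0)} \<union> L \<union> R)" "pverts G = f ` ({(1, 0), (2, 0)} \<union> L \<union> R)"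
    "parcs G = map_prod f f ` (star_arcs (1, 0) L \<union> star_arcs (2, 0) R \<union> star_arcs (1, 0) {(2, 0)})"
    using digraph_iso_with_proj_obtain[OF \<open>pair_wf_digraph G\<close> iso]
    unfolding caterpillar_3_eq L_def[symmetric] R_def[symmetric] by auto
  have disj: "(1, 0) \<notin> L" "(2, 0) \<notin> L" "(1, 0) \<notin> R" "(2, 0) \<notin> R" "L \<inter> R = {}" "L \<noteq> {}" "R \<noteq> {}"
    by (auto simp: L_def R_def)
  show ?thesis
  proof (rule double_star_eccentricity_2[of "f (1, 0)" "f (2, 0)" "f ` L" "f ` R"])
    show "pverts G = {f (1, 0), f (2, 0)} \<union> f ` L \<union> f ` R" using f(2) by auto
    show "parcs G = star_arcs (f (1, 0)) (f ` L) \<union> star_arcs (f (2, 0)) (f ` R) \<union> star_arcs (f (1, 0)) {f (2, 0)}"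
      using f(3) by (simp add: image_Un map_prod_star_arcs)
    show "f ` L \<inter> f ` R = {}"
      using inj_on_image_Int[OF f(1), of L R] disj by auto
    show "f (1, 0) \<noteq> f (2, 0)" using inj_on_eq_iff[OF f(1), of "(1, 0)" "(2, 0)"] by simp
    show "f (1, 0) \<notin> f ` L" "f (2, 0) \<notin> f ` L" "f (1, 0) \<notin> f ` R" "f (2, 0) \<notin> f ` R"
      using disj inj_on_image_mem_iff[OF f(1), of "(1, 0)" L] inj_on_image_mem_iff[OF f(1), of "(1, 0)" R]
        inj_on_image_mem_iff[OF f(1), of "(2, 0)" L] inj_on_image_mem_iff[OF f(1), of "(2, 0)" R] by auto
  qed (use disj e in auto)
qed

end

section \<open>Trees of diameter 2 and 3 are stars and double stars\<close>

context undirected_tree_graph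
begin

text \<open>An edge avoiding \<open>c\<close> would join two vertices at distance exactly 1 from
  \<open>c\<close>, which \<open>graph_dist_arc_cases\<close> excludes.\<close>

lemma star_structure:
  assumes c: "c \<in> pverts G" and near: "\<And>w. w \<in> pverts G \<Longrightarrow> graph_dist G c w \<le> 1"
  shows "parcs G = star_arcs c (pverts G - {c})"
proof -
  have adj: "(c, w) \<in> parcs G" if "w \<in> pverts G - {c}" for w
    using near[of w] graph_dist_eq_1_iff[OF c, of w] graph_dist_eq_0_iff[OF c, of w] that
    by (cases "graph_dist G c w") auto
  have "x = c \<or> y = c" if "(x, y) \<in> parcs G" for x y
    using graph_dist_arc_cases[OF c that] near[of x] near[of y] graph_dist_eq_0_iff[OF c]
      wellformed'[OF that] that by (metis le_Suc_eq le_zero_eq One_nat_def Suc_inject)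
  then show ?thesis
    using adj arcs_symmetric no_loops' wellformed' unfolding star_arcs_def by fast
qed

lemma star_in_S_class:
  assumes c: "c \<in> pverts G" and E: "parcs G = star_arcs c (pverts G - {c})"
  shows "G \<in> S_class (order_of G)"
proof -
  define n where "n = order_of G"
  have n: "n = card (pverts G)" "0 < n"
    using c pair_finite_verts by (auto simp: n_def order_of_def card_gt_0_iff)
  have "card (pverts G - {c}) = card {1..<n}" using c n by simp
  then obtain g where g: "bij_betw g (pverts G - {c}) {1..<n}"
    using finite_same_card_bij[of "pverts G - {c}" "{1..<n}"] pair_finite_verts by auto
  define f where "f = g(c := 0)"
  have img: "f ` (pverts G - {c}) = {1..<n}" "f c = 0"
    using g by (auto simp: f_def bij_betw_def)
  have V: "pverts G = insert c (pverts G - {c})" using c by blast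
  have "inj_on f (pverts G - {c})"
    using g by (auto simp: f_def bij_betw_def inj_on_def)
  then have "inj_on f (insert c (pverts G - {c}))"
    using img by (subst inj_on_insert) auto
  then have "inj_on f (pverts G)" using V by simp
  moreover have "f ` pverts G = {..<n}"
  proof -
    have "f ` pverts G = insert 0 {1..<n}" by (subst V) (simp only: image_insert img)
    then show ?thesis using n(2) by auto
  qed
  moreover have "map_prod f f ` parcs G = star_arcs 0 {1..<n}"
    using img by (subst E) (simp add: map_prod_star_arcs)
  moreover have "pair_wf_digraph G" by unfold_locales
  ultimately have "digraph_iso (with_proj G) (with_proj (star_graph n))"
    by (auto simp: digraph_iso_with_proj_iff star_graph_eq)
  then show ?thesis using pair_graph by (simp add: S_class_def n_def)
qed

text \<open>Let \<open>c\<close> be the midpoint of a diametral path. Seen from a vertex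
  \<open>w\<close> at distance at least 2 from \<open>c\<close>, neither \<open>u\<close> nor
  \<open>v\<close> can lie beyond \<open>c\<close>, so both are parents of \<open>c\<close> with
  respect to \<open>w\<close>, which contradicts uniqueness.\<close>

lemma diameter_2_S_class:
  assumes "graph_diameter G = 2"
  shows "G \<in> S_class (order_of G)"
proof -
  obtain u v where uv: "u \<in> pverts G" "v \<in> pverts G" "graph_dist G u v = 2"
    using diameter_obtain assms by metis
  obtain c where c: "(v, c) \<in> parcs G" "graph_dist G u c = 1"
    using graph_dist_Suc_obtain[OF uv(1,2)] uv(3) by (metis One_nat_def numeral_2_eq_2)
  have cV: "c \<in> pverts G" using c wellformed' by blast
  have cu: "(c, u) \<in> parcs G"
    using c(2) graph_dist_eq_1_iff[OF uv(1) cV] arcs_symmetric by blast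
  have "graph_dist G c w \<le> 1" if w: "w \<in> pverts G" for w
  proof (rule ccontr)
    assume "\<not> ?thesis"
    then have far: "2 \<le> graph_dist G w c" using graph_dist_commute[OF cV w] by simp
    have "graph_dist G w u \<le> 2" "graph_dist G w v \<le> 2"
      using graph_dist_le_diameter w uv assms by metis+
    with far graph_dist_arc_cases[OF w cu] graph_dist_arc_cases[OF w arcs_symmetric[OF c(1)]]
    have "u = v"
      by (intro parent_unique[OF w cu arcs_symmetric[OF c(1)]]) auto
    with uv show False by simp
  qed
  from star_in_S_class[OF cV star_structure[OF cV this]] show ?thesis .
qed

lemma double_star_in_C_class:
  assumes V: "pverts G = {x, y} \<union> A \<union> B"
    and E: "parcs G = star_arcs x A \<union> star_arcs y B \<union> star_arcs x {y}"
    and disj: "A \<noteq> {}" "B \<noteq> {}" "x \<noteq> y" "x \<notin> A" "y \<notin> A" "x \<notin> B" "y \<notin> B" "A \<inter> B = {}"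
  shows "G \<in> C_class (order_of G) 3"
proof -
  \<comment> \<open>One leaf of each centre becomes the path end \<open>(0, 0)\<close> or
    \<open>(3, 0)\<close>; hence the subtraction of 1.\<close>
  define a where "a i = (if i = 1 then card A - 1 else card B - 1)" for i :: nat
  have fin: "finite A" "finite B" using V pair_finite_verts by auto
  define L R where "L = insert (0::nat, 0::nat) (Pair 1 ` {1..a 1})"
    and "R = insert (3::nat, 0::nat) (Pair 2 ` {1..a 2})"
  have pendent: "card (Pair i ` {1..k}) = k" for i k :: nat
    by (simp add: card_image inj_on_def)
  have "(0::nat, 0) \<notin> Pair 1 ` {1..a 1}" "(3::nat, 0) \<notin> Pair 2 ` {1..a 2}" by auto
  then have "card L = Suc (a 1)" "card R = Suc (a 2)"
    by (simp_all only: L_def R_def card_insert_disjoint finite_imageI finite_atLeastAtMost pendent simp_thms)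
  moreover have "0 < card A" "0 < card B" using fin disj by (simp_all add: card_gt_0_iff)
  ultimately have "card A = card L" "card B = card R" by (simp_all add: a_def)
  moreover have "finite L" "finite R" by (simp_all add: L_def R_def)
  ultimately obtain g h where g: "bij_betw g A L" and h: "bij_betw h B R"
    using finite_same_card_bij[of A L] finite_same_card_bij[of B R] fin by auto
  have LR: "(1, 0) \<notin> L" "(2, 0) \<notin> L" "(1, 0) \<notin> R" "(2, 0) \<notin> R" "L \<inter> R = {}"
    by (auto simp: L_def R_def)
  define f where "f z = (if z = x then (1, 0) else if z = y then (2, 0) else if z \<in> A then g z else h z)"
    for z
  have f: "f x = (1, 0)" "f y = (2, 0)" using disj by (auto simp: f_def)
  have fA: "bij_betw f A L"
    using g disj by (subst bij_betw_cong[where g = g]) (auto simp: f_def)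
  have fB: "bij_betw f B R"
    using h disj by (subst bij_betw_cong[where g = h]) (auto simp: f_def)
  have "bij_betw f {x, y} {(1, 0), (2, 0)}" using f disj by (auto simp: bij_betw_def)
  from bij_betw_combine[OF this fA] have "bij_betw f ({x, y} \<union> A) ({(1, 0), (2, 0)} \<union> L)"
    using LR by auto
  from bij_betw_combine[OF this fB] have bij: "bij_betw f (pverts G) ({(1, 0), (2, 0)} \<union> L \<union> R)"
    unfolding V using LR by auto
  have "map_prod f f ` parcs G = star_arcs (1, 0) L \<union> star_arcs (2, 0) R \<union> star_arcs (1, 0) {(2, 0)}"
    using fA fB f unfolding E by (simp add: image_Un map_prod_star_arcs bij_betw_def)
  moreover have "pair_wf_digraph G" by unfold_locales
  ultimately have "digraph_iso (with_proj G) (with_proj (caterpillar 3 a))"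
    using bij unfolding caterpillar_3_eq L_def[symmetric] R_def[symmetric]
    by (auto simp: digraph_iso_with_proj_iff bij_betw_def)
  moreover have "i = 1 \<or> i = 2" if "i \<in> {1..<3::nat}" for i using that by auto
  ultimately show ?thesis
    using pair_graph by (auto simp: C_class_def intro!: exI[of _ a])
qed

text \<open>Let \<open>u\<close>, \<open>x\<close>, \<open>y\<close>, \<open>v\<close> be a
  diametral path. A vertex \<open>w\<close> at distance at least 2 from both \<open>x\<close> and
  \<open>y\<close> reaches the edge between them at one end first; continuing through the other end
  to \<open>u\<close> or \<open>v\<close> gives distance at least 4.\<close>

lemma diameter_3_C_class:
  assumes "graph_diameter G = 3"
  shows "G \<in> C_class (order_of G) 3"
proof -
  obtain u v where uv: "u \<in> pverts G" "v \<in> pverts G" "graph_dist G u v = 3"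
    using diameter_obtain assms by metis
  obtain y where y: "(v, y) \<in> parcs G" "graph_dist G u y = 2"
    using graph_dist_Suc_obtain[OF uv(1,2), of 2] uv(3) by auto
  have yV: "y \<in> pverts G" using y wellformed' by blast
  obtain x where x: "(y, x) \<in> parcs G" "graph_dist G u x = 1"
    using graph_dist_Suc_obtain[OF uv(1) yV, of 1] y(2) by auto
  have xV: "x \<in> pverts G" using x wellformed' by blast
  have xu: "(x, u) \<in> parcs G" using x(2) graph_dist_eq_1_iff[OF uv(1) xV] arcs_symmetric by blast
  have xy: "(x, y) \<in> parcs G" and yv: "(y, v) \<in> parcs G"
    using x y arcs_symmetric by blast+
  have "x \<noteq> y" "x \<noteq> v" "u \<noteq> y" using x y uv by auto
  define A B where "A = {w. (x, w) \<in> parcs G} - {y}" and "B = {w. (y, w) \<in> parcs G} - {x}"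
  have near: "w \<in> {x, y} \<union> A \<union> B" if w: "w \<in> pverts G" for w
  proof (rule ccontr)
    assume out: "w \<notin> {x, y} \<union> A \<union> B"
    have "graph_dist G w x \<noteq> 0" "graph_dist G w y \<noteq> 0" "graph_dist G w x \<noteq> 1" "graph_dist G w y \<noteq> 1"
      using out w xV yV graph_dist_eq_0_iff[OF w] graph_dist_eq_1_iff[OF w] arcs_symmetric
      by (auto simp: A_def B_def)
    then have far: "2 \<le> graph_dist G w x" "2 \<le> graph_dist G w y" by linarith+
    have le: "graph_dist G w u \<le> 3" "graph_dist G w v \<le> 3"
      using graph_dist_le_diameter w uv assms by metis+
    show False using graph_dist_arc_cases[OF w xy]
    proof
      assume "graph_dist G w x = Suc (graph_dist G w y)"
      then show False
        using graph_dist_no_backtrack[OF w x(1) xu] \<open>u \<noteq> y\<close> far le by auto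
    next
      assume "graph_dist G w y = Suc (graph_dist G w x)"
      then show False
        using graph_dist_no_backtrack[OF w xy yv] \<open>x \<noteq> v\<close> far le by auto
    qed
  qed
  have dxA: "graph_dist G x w = 1" if "w \<in> A" for w
    using that wellformed'(2)[of x w] graph_dist_eq_1_iff[OF xV, of w] by (auto simp: A_def)
  have dxB: "graph_dist G x w = 2" if "w \<in> B" for w
    using that graph_dist_no_backtrack[OF xV xy, of w] xV yV xy graph_dist_eq_1_iff[OF xV yV]
    by (auto simp: B_def)
  have dxy: "graph_dist G x y = 1" using xV yV xy graph_dist_eq_1_iff by blast
  have V: "pverts G = {x, y} \<union> A \<union> B"
    using near xV yV wellformed' by (auto simp: A_def B_def)
  have disj: "A \<inter> B = {}" using dxA dxB by force
  have arcs: "(w, z) \<in> star_arcs x A \<union> star_arcs y B \<union> star_arcs x {y}" if wz: "(w, z) \<in> parcs G" for w z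
  proof -
    have "w \<in> {x, y} \<or> z \<in> {x, y}"
    proof (rule ccontr)
      assume "\<not> ?thesis"
      then have AB: "w \<in> A \<union> B" "z \<in> A \<union> B" using wellformed'[OF wz] V by auto
      \<comment> \<open>Seen from \<open>x\<close>, the sets \<open>A\<close> and \<open>B\<close>
        are levels 1 and 2. Edges inside a level are excluded by
        \<open>graph_dist_arc_cases\<close>; an edge between the levels would give \<open>q\<close>
        a second parent besides \<open>y\<close>.\<close>
      have no: False if "p \<in> A" "q \<in> B" "(q, p) \<in> parcs G" for p q
      proof -
        have "p = y"
          by (rule parent_unique[OF xV that(3)]) (use that dxA dxB dxy arcs_symmetric in \<open>auto simp: B_def\<close>)
        with that show False by (simp add: A_def)
      qed
      show False
        using AB graph_dist_arc_cases[OF xV wz] dxA dxB no[of w z] no[of z w] wz arcs_symmetric[OF wz]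
        by fastforce
    qed
    then show ?thesis
      using wz arcs_symmetric[OF wz] no_loops'[OF wz] by (auto simp: star_arcs_def A_def B_def)
  qed
  have E: "parcs G = star_arcs x A \<union> star_arcs y B \<union> star_arcs x {y}"
  proof
    show "star_arcs x A \<union> star_arcs y B \<union> star_arcs x {y} \<subseteq> parcs G"
      using xy x(1) arcs_symmetric by (auto simp: star_arcs_def A_def B_def)
  qed (use arcs in auto)
  have "u \<in> A" "v \<in> B" "x \<notin> A" "y \<notin> A" "x \<notin> B" "y \<notin> B"
    using xu yv \<open>u \<noteq> y\<close> \<open>x \<noteq> v\<close> no_loops' by (auto simp: A_def B_def)
  then show ?thesis
    using double_star_in_C_class[OF V E] disj \<open>x \<noteq> y\<close> by blast
qed

text \<open>This excludes the star on two vertices, whose only edge has eccentricity 1 at both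
  ends.\<close>

lemma order_ge_3:
  assumes "2 \<le> graph_diameter G"
  shows "3 \<le> order_of G"
proof -
  obtain u v where uv: "u \<in> pverts G" "v \<in> pverts G" "graph_dist G u v = Suc (graph_diameter G - 1)"
    using diameter_obtain assms by (metis One_nat_def Suc_diff_1 less_le_trans pos2)
  obtain c where c: "(v, c) \<in> parcs G" "graph_dist G u c = graph_diameter G - 1"
    using graph_dist_Suc_obtain[OF uv] .
  have "u \<noteq> v" "u \<noteq> c" using uv c assms by auto
  then have "card {u, v, c} = 3" using no_loops'[OF c(1)] by simp
  moreover have "{u, v, c} \<subseteq> pverts G" using uv c wellformed' by auto
  ultimately show ?thesis
    unfolding order_of_def using card_mono[OF pair_finite_verts] by metis
qed

text \<open>If all distances were at most 1, \<open>star_structure\<close> would leave two vertices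
  other than \<open>c\<close> nonadjacent, which is absurd.\<close>

lemma diameter_ge_2:
  assumes "3 \<le> order_of G"
  shows "2 \<le> graph_diameter G"
proof (rule ccontr)
  assume "\<not> ?thesis"
  then have le: "graph_dist G u v \<le> 1" if "u \<in> pverts G" "v \<in> pverts G" for u v
    using graph_dist_le_diameter[OF that] by simp
  obtain c where c: "c \<in> pverts G" using verts_nonempty by blast
  have E: "parcs G = star_arcs c (pverts G - {c})"
    by (rule star_structure[OF c le[OF c]])
  have "card (pverts G - {c}) \<ge> 2" using assms c by (simp add: order_of_def)
  then obtain x y where xy: "x \<in> pverts G" "y \<in> pverts G" "x \<noteq> c" "y \<noteq> c" "x \<noteq> y"
    by (metis card_le_Suc0_iff_eq pair_finite_verts finite_Diff Diff_iff insertI1 not_less_eq_eq numeral_2_eq_2 One_nat_def)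
  then have "(x, y) \<notin> parcs G" by (subst E) (auto simp: star_arcs_def)
  with le[OF xy(1,2)] graph_dist_eq_0_iff[OF xy(1,2)] graph_dist_eq_1_iff[OF xy(1,2)] xy show False
    by linarith
qed

lemma ABC3_eq_iff_class:
  assumes "2 \<le> graph_diameter G"
  shows "ABC3 G = (real (order_of G) - 1) * sqrt (1 / 2) \<longleftrightarrow>
    G \<in> C_class (order_of G) 3 \<union> S_class (order_of G)"
proof -
  have "(\<forall>e\<in>uedges G. \<exists>x\<in>e. eccentricity G x = 2) \<longleftrightarrow>
      G \<in> C_class (order_of G) 3 \<union> S_class (order_of G)" (is "?L \<longleftrightarrow> ?R")
  proof
    assume ?L
    then have "graph_diameter G = 2 \<or> graph_diameter G = 3"
      using diameter_le_3 assms by force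
    then show ?R using diameter_2_S_class diameter_3_C_class by blast
  next
    assume ?R
    then show ?L
      using C_class_3_eccentricity_2 S_class_eccentricity_2[OF _ order_ge_3[OF assms]] by blast
  qed
  then show ?thesis by (simp only: ABC3_eq_iff)
qed

lemma ABC3_le_second:
  assumes "3 \<le> order_of G" "G \<notin> C_class (order_of G) 3 \<union> S_class (order_of G)"
  shows "ABC3 G \<le> (real (order_of G) - 3) * sqrt (1 / 2) + 2 * sqrt (5 / 12)"
proof -
  have "graph_diameter G \<noteq> 2" "graph_diameter G \<noteq> 3"
    using diameter_2_S_class diameter_3_C_class assms(2) by blast+
  with diameter_ge_2[OF assms(1)] show ?thesis
    by (intro ABC3_le_diameter_ge_4) linarith
qed

end


section \<open>The second maximum\<close>

text \<open>A vertex of maximal level on a cycle has two distinct neighbours of no larger level.\<close>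

lemma (in pair_graph) no_cycle_if_unique_parent:
  fixes lev :: "'a \<Rightarrow> nat"
  assumes unique: "\<And>x y z. (x, y) \<in> parcs G \<Longrightarrow> (x, z) \<in> parcs G \<Longrightarrow>
      lev y \<le> lev x \<Longrightarrow> lev z \<le> lev x \<Longrightarrow> y = z"
    and cyc: "cycle p"
  shows "length p < 3"
proof (rule ccontr)
  assume "\<not> length p < 3"
  then have len: "3 \<le> length p" by simp
  obtain u where u: "awalk u p u" "distinct (tl (pawalk_verts u p))" "p \<noteq> []"
    using cyc by (auto simp: cycle_def)
  have heads: "distinct (map snd p)"
    using u awalk_verts_conv'[of u p u] by auto
  obtain e where e: "e \<in> set p" and e_max: "\<And>e'. e' \<in> set p \<Longrightarrow> lev (fst e') \<le> lev (fst e)"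
  proof -
    have "Max ((\<lambda>e. lev (fst e)) ` set p) \<in> (\<lambda>e. lev (fst e)) ` set p"
      using u(3) by (intro Max_in) auto
    then obtain e where "e \<in> set p" "lev (fst e) = Max ((\<lambda>e. lev (fst e)) ` set p)" by auto
    moreover have "lev (fst e') \<le> Max ((\<lambda>e. lev (fst e)) ` set p)" if "e' \<in> set p" for e'
      using that by (intro Max_ge) auto
    ultimately show thesis using that by metis
  qed
  obtain p1 p2 where p: "p = p1 @ e # p2" using e by (auto simp: in_set_conv_decomp)
  \<comment> \<open>The cycle is rotated to start at the vertex of maximal level. Its first arc
    \<open>e\<close> leads to one neighbour, its last arc \<open>e3\<close> comes from another; they
    differ because \<open>e\<close> and \<open>e2\<close> have different heads.\<close>
  define q where "q = e # p2 @ p1"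
  have "awalk (fst e) q (fst e)"
    using u(1) unfolding p q_def by (auto simp: awalk_simps)
  moreover have "length q = length p" "set q = set p" "distinct (map snd q)"
    using heads by (auto simp: p q_def)
  moreover obtain e2 e3 q' where q': "p2 @ p1 = q' @ [e2, e3]"
  proof -
    have "2 \<le> length (p2 @ p1)" using len by (simp add: p)
    then obtain xs e3 where "p2 @ p1 = xs @ [e3]" and "xs \<noteq> []"
      by (cases "p2 @ p1" rule: rev_cases) (simp, fastforce)
    moreover from this obtain q' e2 where "xs = q' @ [e2]"
      by (cases xs rule: rev_cases) auto
    ultimately show thesis using that by simp
  qed
  ultimately have arcs: "e \<in> parcs G" "e2 \<in> parcs G" "e3 \<in> parcs G" "snd e2 = fst e3" "snd e3 = fst e"
    and ne: "snd e \<noteq> snd e2" and mem: "e3 \<in> set p" "e \<in> set p"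
    by (auto simp: q_def awalk_simps)
  \<comment> \<open>Maximality is known for tails of arcs only, so the head of \<open>e\<close> has
    to be exhibited as the tail of the next arc.\<close>
  obtain e' where e': "e' \<in> set p" "fst e' = snd e"
  proof -
    have "q' @ [e2, e3] \<noteq> []" by simp
    then obtain e' qs where "p2 @ p1 = e' # qs" using q' by (metis neq_Nil_conv)
    moreover have "awalk (snd e) (p2 @ p1) (fst e)"
      using \<open>awalk (fst e) q (fst e)\<close> by (simp add: q_def awalk_Cons_iff)
    ultimately have "e' \<in> set p" "fst e' = snd e"
      using \<open>set q = set p\<close> by (auto simp: q_def awalk_Cons_iff)
    then show thesis using that by blast
  qed
  have "snd e = fst e3"
  proof (rule unique[of "fst e"])
    show "(fst e, snd e) \<in> parcs G" using arcs by simp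
    show "(fst e, fst e3) \<in> parcs G" using arcs_symmetric[of "fst e3" "snd e3"] arcs by (metis prod.collapse)
    show "lev (snd e) \<le> lev (fst e)" using e_max[OF e'(1)] e'(2) by simp
    show "lev (fst e3) \<le> lev (fst e)" using e_max[OF mem(1)] .
  qed
  with ne arcs show False by simp
qed

lemma (in pair_graph) connected_if_center:
  assumes c: "c \<in> pverts G" and walk: "\<And>v. v \<in> pverts G \<Longrightarrow> \<exists>p. awalk c p v"
  shows "connected (with_proj G)"
proof (rule connectedI)
  show "pverts G \<noteq> {}" using c by auto
  fix u v assume "u \<in> pverts G" "v \<in> pverts G"
  then obtain p q where "awalk c p u" "awalk c q v" using walk by metis
  then have "awalk u (rev_path p @ q) v" by (intro awalk_appendI) auto
  then have "u \<rightarrow>\<^sup>*\<^bsub>with_proj G\<^esub> v" by (rule reachable_awalkI)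
  then show "u \<rightarrow>\<^sup>*\<^bsub>with_proj (mk_symmetric (with_proj G))\<^esub> v" by (rule reachable_mk_symmetricI)
qed

text \<open>Here \<open>c\<close> is v_2, \<open>p\<close> and \<open>q\<close> are v_1 and v_3, and
  \<open>p'\<close> and \<open>q'\<close> are v_0 and v_4. The eccentricities are 2 at
  \<open>c\<close>, 3 on \<open>A\<close> and 4 at \<open>p'\<close> and \<open>q'\<close>, so
  exactly the two outer edges miss eccentricity 2.\<close>

lemma
  assumes G: "pair_graph G"
    and V: "pverts G = {c, p', q'} \<union> A"
    and E: "parcs G = star_arcs c A \<union> star_arcs p {p'} \<union> star_arcs q {q'}"
    and pq: "p \<in> A" "q \<in> A" "p \<noteq> q"
    and distinct: "c \<notin> A" "p' \<notin> A" "q' \<notin> A" "c \<noteq> p'" "c \<noteq> q'" "p' \<noteq> q'"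
  shows spider_undirected_tree: "undirected_tree G"
    and spider_ABC3: "ABC3 G = (real (order_of G) - 3) * sqrt (1 / 2) + 2 * sqrt (5 / 12)"
proof -
  interpret pair_graph G by fact
  define lev :: "'a \<Rightarrow> nat" where "lev z = (if z = c then 0 else if z \<in> A then 1 else 2)" for z
  \<comment> \<open>\<open>g\<close> is 1-Lipschitz, so it bounds the distances to \<open>p'\<close> and \<open>q'\<close> from below; these bounds are
    sharp because \<open>lev = \<bar>g - 2\<bar>\<close> is the distance to \<open>c\<close>.\<close>
  define g :: "'a \<Rightarrow> nat" where
    "g z = (if z = p' then 0 else if z = p then 1 else if z = c then 2 else if z = q' then 4 else 3)" for z
  have ne: "c \<noteq> p" "c \<noteq> q" "p \<noteq> p'" "q \<noteq> q'" "p \<noteq> q'" "q \<noteq> p'" using pq distinct by auto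
  have lev: "lev c = 0" "lev p' = 2" "lev q' = 2" "\<And>x. x \<in> A \<Longrightarrow> lev x = 1"
    using distinct by (auto simp: lev_def)
  have arc_lev: "(x = c \<and> y \<in> A) \<or> (x \<in> A \<and> y = c) \<or> (x = p \<and> y = p') \<or> (x = p' \<and> y = p)
      \<or> (x = q \<and> y = q') \<or> (x = q' \<and> y = q)" if "(x, y) \<in> parcs G" for x y
    using that by (auto simp: E star_arcs_def)
  \<comment> \<open>The only neighbour of no larger level is \<open>c\<close> for a vertex of
    \<open>A\<close>, \<open>p\<close> for \<open>p'\<close> and \<open>q\<close> for
    \<open>q'\<close>; the vertex \<open>c\<close> has none.\<close>
  have no_cycle: "length w < 3" if "cycle w" for w
  proof (rule no_cycle_if_unique_parent[OF _ that, of lev])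
    fix x y z assume xy: "(x, y) \<in> parcs G" and xz: "(x, z) \<in> parcs G"
      and le: "lev y \<le> lev x" "lev z \<le> lev x"
    show "y = z"
      using arc_lev[OF xy] arc_lev[OF xz] le lev pq ne distinct by - (elim disjE; force)
  qed
  have arcs: "\<And>x. x \<in> A \<Longrightarrow> (c, x) \<in> parcs G" "(p, p') \<in> parcs G" "(q, q') \<in> parcs G"
    by (auto simp: E star_arcs_def)
  have "connected (with_proj G)"
  proof (rule connected_if_center[of c])
    show cV: "c \<in> pverts G" using V by simp
    fix v assume "v \<in> pverts G"
    then consider "v = c" | "v = p'" | "v = q'" | "v \<in> A" using V by auto
    then show "\<exists>w. awalk c w v"
    proof cases
      case 1
      then show ?thesis using cV by (intro exI[of _ "[]"]) (simp add: awalk_simps)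
    next
      case 2
      then show ?thesis using V arcs pq by (intro exI[of _ "[(c, p), (p, p')]"]) (simp add: awalk_simps)
    next
      case 3
      then show ?thesis using V arcs pq by (intro exI[of _ "[(c, q), (q, q')]"]) (simp add: awalk_simps)
    next
      case 4
      then show ?thesis using V arcs by (intro exI[of _ "[(c, v)]"]) (simp add: awalk_simps)
    qed
  qed
  then interpret undirected_tree_graph G
    using no_cycle by unfold_locales auto
  show "undirected_tree G" unfolding undirected_tree_iff by unfold_locales
  have cV: "c \<in> pverts G" and p'V: "p' \<in> pverts G" and q'V: "q' \<in> pverts G" using V by auto
  have dist_A: "graph_dist G c x \<le> 1" if "x \<in> A" for x
    using graph_dist_eq_1_iff[of c x] arcs(1)[OF that] that V by auto
  have "graph_dist G c p' \<le> 2" "graph_dist G c q' \<le> 2"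
    using graph_dist_arc_le[OF cV arcs(2)] graph_dist_arc_le[OF cV arcs(3)] dist_A pq by fastforce+
  then have dist_c: "graph_dist G c x \<le> lev x" if "x \<in> pverts G" for x
    using that V dist_A lev cV by auto
  have g: "g y \<le> g x + 1" if "(x, y) \<in> parcs G" for x y
    using arc_lev[OF that] pq ne distinct by - (elim disjE; force simp: g_def)
  have lev_g: "int (lev x) = \<bar>int (g x) - 2\<bar>" if "x \<in> pverts G" for x
    using that V pq ne distinct by (auto simp: g_def lev_def)
  have g_ends: "g p' = 0" "g q' = 4" using pq ne distinct by (auto simp: g_def)
  have lev_le: "lev x \<le> 2" for x by (simp add: lev_def)
  have ecc: "eccentricity G x = lev x + 2" if x: "x \<in> pverts G" for x
  proof (rule antisym)
    have "graph_dist G x v \<le> lev x + 2" if v: "v \<in> pverts G" for v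
      using graph_dist_triangle[OF x cV v] graph_dist_commute[OF x cV] dist_c[OF x] dist_c[OF v] lev_le[of v]
      by linarith
    then show "eccentricity G x \<le> lev x + 2" by (simp add: eccentricity_le_iff)
    \<comment> \<open>The distances from \<open>x\<close> to \<open>p'\<close> and \<open>q'\<close>
      are at least \<open>g x\<close> and \<open>4 - g x\<close>, and the larger of these two
      numbers is \<open>lev x + 2\<close>.\<close>
    have "g x \<le> graph_dist G p' x" "4 \<le> g x + graph_dist G x q'"
      using lipschitz_graph_dist[of g, OF g p'V x] lipschitz_graph_dist[of g, OF g x q'V] g_ends by simp_all
    then have "g x \<le> eccentricity G x" "4 \<le> g x + eccentricity G x"
      using graph_dist_commute[OF x p'V] graph_dist_le_eccentricity[OF p'V, of x]
        graph_dist_le_eccentricity[OF q'V, of x] by linarith+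
    then show "lev x + 2 \<le> eccentricity G x" using lev_g[OF x] by linarith
  qed
  define P where "P = {{p, p'}, {q, q'}}"
  have P: "P \<subseteq> uedges G" "finite P" "card P = 2"
    using arcs(2,3) pq ne distinct by (auto simp: P_def uedges_def doubleton_eq_iff)
  have "edge_weight e = sqrt (5 / 12)" if "e \<in> P" for e
    using that edge_weight_arc[OF arcs(2)] edge_weight_arc[OF arcs(3)] ecc lev pq V
    by (auto simp: P_def abc_weight_def)
  then have sumP: "sum edge_weight P = 2 * sqrt (5 / 12)" using P by simp
  have "edge_weight e = sqrt (1 / 2)" if e: "e \<in> uedges G - P" for e
  proof -
    obtain x y where xy: "(x, y) \<in> parcs G" "e = {x, y}" using uedges_cases e by blast
    have "c \<in> e" using arc_lev[OF xy(1)] xy(2) e by (auto simp: P_def insert_commute)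
    moreover have "eccentricity G c = 2" using ecc[OF cV] lev by simp
    ultimately show ?thesis using edge_weight_eq_iff[of e] e by blast
  qed
  then have "sum edge_weight (uedges G - P) = real (card (uedges G - P)) * sqrt (1 / 2)" by simp
  moreover have "real (card (uedges G - P)) = real (order_of G) - 3"
    using P finite_uedges card_mono[OF finite_uedges P(1)] real_card_uedges
    by (simp add: card_Diff_subset of_nat_diff)
  moreover have "ABC3 G = sum edge_weight (uedges G - P) + sum edge_weight P"
    unfolding ABC3_eq using P finite_uedges by (intro sum.subset_diff)
  ultimately show "ABC3 G = (real (order_of G) - 3) * sqrt (1 / 2) + 2 * sqrt (5 / 12)"
    using sumP by simp
qed

lemma C_class_4_properties:
  assumes G: "G \<in> C_class n 4"
  shows "undirected_tree G" and "order_of G = n"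
    and "ABC3 G = (real n - 3) * sqrt (1 / 2) + 2 * sqrt (5 / 12)"
proof -
  from G have pg: "pair_graph G" and order: "order_of G = n" by (auto simp: C_class_def)
  from pg interpret pair_graph G .
  have wf: "pair_wf_digraph G" by unfold_locales
  from G obtain a where a: "\<forall>i\<in>{1..<4}. a i \<noteq> 0 \<longrightarrow> i = (2::nat)"
    and iso: "digraph_iso (with_proj G) (with_proj (caterpillar 4 a))"
    by (auto simp: C_class_def)
  have a13: "a 1 = 0" "a 3 = 0" using bspec[OF a, of 1] bspec[OF a, of 3] by auto
  define A where "A = {(1::nat, 0::nat), (3, 0)} \<union> Pair 2 ` {1..a 2}"
  define W where "W = {(2::nat, 0::nat), (0, 0), (4, 0)} \<union> A"
  obtain f where f: "inj_on f W" "pverts G = f ` W"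
    "parcs G = map_prod f f ` (star_arcs (2, 0) A \<union> star_arcs (1, 0) {(0, 0)} \<union> star_arcs (3, 0) {(4, 0)})"
    using digraph_iso_with_proj_obtain[OF wf iso]
    unfolding caterpillar_4_eq[OF a13, folded A_def, folded W_def] by auto
  have A: "(2, 0) \<notin> A" "(0, 0) \<notin> A" "(4, 0) \<notin> A" "A \<subseteq> W" by (auto simp: A_def W_def)
  have V: "pverts G = {f (2, 0), f (0, 0), f (4, 0)} \<union> f ` A" using f(2) by (auto simp: W_def)
  have E: "parcs G = star_arcs (f (2, 0)) (f ` A) \<union> star_arcs (f (1, 0)) {f (0, 0)} \<union> star_arcs (f (3, 0)) {f (4, 0)}"
    using f(3) by (simp add: image_Un map_prod_star_arcs)
  have W: "(0, 0) \<in> W" "(1, 0) \<in> W" "(2, 0) \<in> W" "(3, 0) \<in> W" "(4, 0) \<in> W" by (auto simp: W_def A_def)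
  note eq = inj_on_eq_iff[OF f(1)] and mem = inj_on_image_mem_iff[OF f(1) _ A(4)]
  have "f (1, 0) \<in> f ` A" "f (3, 0) \<in> f ` A" "f (1, 0) \<noteq> f (3, 0)"
    "f (2, 0) \<notin> f ` A" "f (0, 0) \<notin> f ` A" "f (4, 0) \<notin> f ` A"
    "f (2, 0) \<noteq> f (0, 0)" "f (2, 0) \<noteq> f (4, 0)" "f (0, 0) \<noteq> f (4, 0)"
    using W A by (simp_all add: eq mem) (simp_all add: A_def)
  from spider_undirected_tree[OF pg V E this] spider_ABC3[OF pg V E this] order show "undirected_tree G" "order_of G = n"
    "ABC3 G = (real n - 3) * sqrt (1 / 2) + 2 * sqrt (5 / 12)" by simp_all
qed

text \<open>A type with fewer than \<open>n\<close> elements carries no graph of order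
  \<open>n\<close>, so existence is stated over \<open>nat\<close>. The caterpillar lives on pairs
  and is transported along \<open>prod_encode\<close>.\<close>

lemma C_class_4_nonempty:
  assumes "5 \<le> n"
  shows "(C_class n 4 :: nat pair_pre_digraph set) \<noteq> {}"
proof -
  define a :: "nat \<Rightarrow> nat" where "a i = (if i = 2 then n - 5 else 0)" for i
  define A where "A = {(1::nat, 0::nat), (3, 0)} \<union> Pair 2 ` {1..a 2}"
  define W where "W = {(2::nat, 0::nat), (0, 0), (4, 0)} \<union> A"
  define H where "H = caterpillar 4 a"
  have H: "H = \<lparr>pverts = W, parcs = star_arcs (2, 0) A \<union> star_arcs (1, 0) {(0, 0)} \<union> star_arcs (3, 0) {(4, 0)}\<rparr>"
    unfolding H_def using caterpillar_4_eq[of a] by (simp add: a_def A_def W_def)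
  have fin: "finite A" "finite W" by (auto simp: A_def W_def)
  have "card (Pair (2::nat) ` {1..a 2}) = n - 5"
    by (simp add: card_image inj_on_def a_def)
  then have "card A = n - 3"
    using assms unfolding A_def by (subst card_Un_disjoint) auto
  then have cardW: "card W = n"
    using assms fin unfolding W_def by (subst card_Un_disjoint) (auto simp: A_def)
  define G where "G = \<lparr>pverts = prod_encode ` pverts H, parcs = map_prod prod_encode prod_encode ` parcs H\<rparr>"
  have inj: "inj_on prod_encode X" for X by (rule inj_prod_encode)
  have W: "(2, 0) \<in> W" "(1, 0) \<in> W" "(3, 0) \<in> W" "{(0, 0)} \<subseteq> W" "{(4, 0)} \<subseteq> W" "A \<subseteq> W"
    by (simp_all add: W_def A_def subset_insertI2)
  have sub: "star_arcs c X \<subseteq> W \<times> W" if "c \<in> W" "X \<subseteq> W" for c X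
    using that by (auto simp: star_arcs_def)
  have arcs: "parcs H \<subseteq> W \<times> W"
    unfolding H pair_pre_digraph.simps by (intro Un_least sub W)
  have "sym (star_arcs c X)" for c and X :: "(nat \<times> nat) set"
    by (auto simp: star_arcs_def sym_def)
  then have "sym (parcs H)"
    unfolding H pair_pre_digraph.simps by (intro sym_Un)
  then have sym: "sym (parcs G)" by (auto simp: G_def sym_def)
  have "(2, 0) \<notin> A" by (auto simp: A_def)
  then have loopfree: "x \<noteq> y" if "(x, y) \<in> parcs H" for x y
    using that unfolding H star_arcs_def by auto
  have "pair_graph G"
  proof
    show "finite (pverts G)" using fin by (simp add: G_def H)
    show "finite (parcs G)" using fin finite_subset[OF arcs] by (simp add: G_def)
    show "symmetric (with_proj G)" using sym by (simp add: symmetric_def)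
  next
    fix e assume "e \<in> parcs G"
    then obtain x y where "(x, y) \<in> parcs H" "e = (prod_encode x, prod_encode y)"
      by (auto simp: G_def)
    then show "fst e \<in> pverts G" "snd e \<in> pverts G" "fst e \<noteq> snd e"
      using arcs loopfree[of x y] by (auto simp: G_def H)
  qed
  then interpret pair_graph G .
  have wfG: "pair_wf_digraph G" by unfold_locales
  have wfH: "pair_wf_digraph H" using arcs by unfold_locales (auto simp: H)
  have "digraph_iso (with_proj H) (with_proj G)"
    unfolding digraph_iso_with_proj_iff[OF wfH] using inj by (auto simp: G_def)
  then have "digraph_iso (with_proj G) (with_proj (caterpillar 4 a))"
    using digraph_iso_swap wfH wf_digraph_wp_iff unfolding H_def by blast
  moreover have "order_of G = n"
    using cardW by (simp add: order_of_def G_def H card_image inj)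
  ultimately have "G \<in> C_class n 4"
    using \<open>pair_graph G\<close> by (auto simp: C_class_def a_def split: if_splits intro!: exI[of _ a])
  then show ?thesis by blast
qed

lemma sqrt_5_12_less: "sqrt (5 / 12) < sqrt (1 / 2 :: real)"
  by (rule real_sqrt_less_mono) simp

theorem theorem4p2:
  shows "(\<forall>(T :: 'a pair_pre_digraph) n d.
            undirected_tree T \<and> order_of T = n \<and> graph_diameter T = d \<and> 2 \<le> d \<longrightarrow>
              ABC3 T \<le> (real n - 1) * sqrt (1 / 2) \<and>
              (ABC3 T = (real n - 1) * sqrt (1 / 2) \<longleftrightarrow> T \<in> C_class n 3 \<union> S_class n)) \<and>
         (\<forall>n \<ge> 5.
            (C_class n 4 :: nat pair_pre_digraph set) \<noteq> {} \<and>
            (\<forall>H \<in> (C_class n 4 :: 'b pair_pre_digraph set).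
               undirected_tree H \<and> order_of H = n \<and> H \<notin> C_class n 3 \<union> S_class n \<and>
               (\<forall>T :: 'a pair_pre_digraph.
                  undirected_tree T \<and> order_of T = n \<and> T \<notin> C_class n 3 \<union> S_class n \<longrightarrow>
                    ABC3 T \<le> ABC3 H)))"
proof (intro conjI allI impI ballI)
  fix T :: "'a pair_pre_digraph" and n d
  assume "undirected_tree T \<and> order_of T = n \<and> graph_diameter T = d \<and> 2 \<le> d"
  then have T: "undirected_tree_graph T" and n: "order_of T = n" and d: "2 \<le> graph_diameter T"
    by (auto simp: undirected_tree_iff)
  show "ABC3 T \<le> (real n - 1) * sqrt (1 / 2)"
    using undirected_tree_graph.ABC3_le[OF T] n by simp
  show "ABC3 T = (real n - 1) * sqrt (1 / 2) \<longleftrightarrow> T \<in> C_class n 3 \<union> S_class n"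
    using undirected_tree_graph.ABC3_eq_iff_class[OF T d] n by simp
next
  fix n :: nat assume "5 \<le> n"
  then show "(C_class n 4 :: nat pair_pre_digraph set) \<noteq> {}" by (rule C_class_4_nonempty)
next
  fix n and H :: "'b pair_pre_digraph" assume n: "5 \<le> n" and H: "H \<in> C_class n 4"
  note props = C_class_4_properties[OF H]
  show "undirected_tree H" "order_of H = n" using props by simp_all
  interpret undirected_tree_graph H using props undirected_tree_iff by blast
  have "2 \<le> graph_diameter H" using n props by (intro diameter_ge_2) simp
  \<comment> \<open>Membership in the two classes is refuted by the index: the value of
    \<open>H\<close> falls short of the maximum by 2(sqrt(1/2) - sqrt(5/12)) > 0.\<close>
  moreover have "ABC3 H \<noteq> (real (order_of H) - 1) * sqrt (1 / 2)"
    unfolding props left_diff_distrib using sqrt_5_12_less by linarith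
  ultimately show "H \<notin> C_class n 3 \<union> S_class n"
    using ABC3_eq_iff_class props by simp
next
  fix n and H :: "'b pair_pre_digraph" and T :: "'a pair_pre_digraph"
  assume n: "5 \<le> n" and H: "H \<in> C_class n 4"
    and T: "undirected_tree T \<and> order_of T = n \<and> T \<notin> C_class n 3 \<union> S_class n"
  then interpret undirected_tree_graph T using undirected_tree_iff by blast
  have "ABC3 T \<le> (real n - 3) * sqrt (1 / 2) + 2 * sqrt (5 / 12)"
    using ABC3_le_second T n by auto
  then show "ABC3 T \<le> ABC3 H" using C_class_4_properties(3)[OF H] by simp
qed

end
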